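(* Let $a$ and $\lambda$ be complex numbers and let $m,n$ be nonnegative integers, such that all terms below are well defined (for $0\le k\le n$, $0\le i\le m$ no Gamma function in a numerator is evaluated at a pole, and the denominator on the right-hand side is nonzero). For $0\le i\le m$ put $$\Omega(\lambda,a,i,m,n)=\sum_{k=0}^{n}\frac{N_i(k)}{D_i(k)}\,\frac{(-1)^k}{k!},$$ where $$N_i(k)=\Gamma(1+k)\,\Gamma(\tfrac32+k)\,\Gamma(\tfrac{m-i}{2}+\lambda-a+\lambda k)\,\Gamma(\tfrac{1+m-i}{2}+\lambda-a+(1+\lambda)k)\,\Gamma(\tfrac{3+m}{2}-i+\lambda+(1+2\lambda)k)\,\Gamma(1+2a+n+(1+2\lambda)k)\,\Gamma(1-i+2\lambda+(2+4\lambda)k),$$ $$D_i(k)=\Gamma(1+n-k)\,\Gamma(2+n+k)\,\Gamma(\tfrac12+k)\,\Gamma(\tfrac{2-i}{2}+a+\lambda k)\,\Gamma(\tfrac{3-i}{2}+a+(1+\lambda)k)\,\Gamma(\tfrac{1+m}{2}-i+\lambda+(1+2\lambda)k)\,\Gamma(1+2\lambda-2a-n+(1+2\lambda)k)\,\Gamma(2+m-i+2\lambda+(2+4\lambda)k).$$ Then $$\sum_{i=0}^m(-1)^i\frac{(-m)_i}{i!}\,\Omega(\lambda,a,i,m,n)=\frac{(-1)^{n}\,2^{4a-2\lambda-m-1}\,(1+2a-\lambda-\tfrac{m}{2})_n}{(1+2a+2\lambda n+2n)(\lambda-a+\lambda n)\,(1)_n}.$$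
   Context: $(x)_0=1$ and $(x)_n=x(x+1)\cdots(x+n-1)$ for $n\ge 1$ is the shifted factorial. $\Gamma$ is the gamma function (meromorphically continued), with $1/\Gamma$ entire, so $1/\Gamma$ is $0$ at the poles of $\Gamma$ (a factor $\Gamma$ in $D_i(k)$ is to be read as a factor $1/\Gamma$ in $1/D_i(k)$). For complex $s$, $2^s=e^{s\log 2}$. $\Omega(\lambda,a,i,m,n)$ is the value at $z=-1$ of a terminating Fox-Wright function ${}_7\Psi_8$, where in general ${}_p\Psi_q[z]=\sum_{k\ge0}\frac{\prod_{i=1}^p\Gamma(\alpha_i+A_ik)}{\prod_{j=1}^q\Gamma(\beta_j+B_jk)}\frac{z^k}{k!}$; the factor $1/\Gamma(1+n-k)$ makes the series terminate at $k=n$. *)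

theory Defs
  imports "HOL-Analysis.Analysis"
begin

text \<open>
  The arguments of the Gamma factors in the numerator $N_i(k)$ and in the denominator $D_i(k)$ of
  the \<open>k\<close>-th term of $\Omega$. All arithmetic takes place in the complex numbers; in
  particular the differences of \<open>m\<close>, \<open>n\<close>, \<open>i\<close>, \<open>k\<close> are not truncated.
\<close>

definition num_args :: "complex \<Rightarrow> complex \<Rightarrow> nat \<Rightarrow> nat \<Rightarrow> nat \<Rightarrow> nat \<Rightarrow> complex list" where
  "num_args l a i m n k =
     [1 + of_nat k,
      3/2 + of_nat k,
      (of_nat m - of_nat i) / 2 + l - a + l * of_nat k,
      (1 + of_nat m - of_nat i) / 2 + l - a + (1 + l) * of_nat k,
      (3 + of_nat m) / 2 - of_nat i + l + (1 + 2 * l) * of_nat k,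
      1 + 2 * a + of_nat n + (1 + 2 * l) * of_nat k,
      1 - of_nat i + 2 * l + (2 + 4 * l) * of_nat k]"

definition den_args :: "complex \<Rightarrow> complex \<Rightarrow> nat \<Rightarrow> nat \<Rightarrow> nat \<Rightarrow> nat \<Rightarrow> complex list" where
  "den_args l a i m n k =
     [1 + of_nat n - of_nat k,
      2 + of_nat n + of_nat k,
      1/2 + of_nat k,
      (2 - of_nat i) / 2 + a + l * of_nat k,
      (3 - of_nat i) / 2 + a + (1 + l) * of_nat k,
      (1 + of_nat m) / 2 - of_nat i + l + (1 + 2 * l) * of_nat k,
      1 + 2 * l - 2 * a - of_nat n + (1 + 2 * l) * of_nat k,
      2 + of_nat m - of_nat i + 2 * l + (2 + 4 * l) * of_nat k]"

text \<open>
  A Gamma factor of $D_i(k)$ enters as \<^const>\<open>rGamma\<close>, the entire function $1/\Gamma$, which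
  is zero at the poles of $\Gamma$.
\<close>

definition Omega :: "complex \<Rightarrow> complex \<Rightarrow> nat \<Rightarrow> nat \<Rightarrow> nat \<Rightarrow> complex" where
  "Omega l a i m n =
     (\<Sum>k=0..n. (\<Prod>z\<leftarrow>num_args l a i m n k. Gamma z) * (\<Prod>z\<leftarrow>den_args l a i m n k. rGamma z)
               * ((-1) ^ k / fact k))"

end

theory Submission
  imports Defs
begin

text \<open>
  Fix \<open>k\<close> and put $P = (1+2\lambda)k + 2\lambda - 2a$, $Q = (1+2\lambda)k + 2a$, $y = P+Q+1$. The
  factors of the \<open>i\<close>-th summand that depend on \<open>i\<close> are a binomial coefficient, the rational
  function $(y+m-2i)/(y-i)_{m+1}$ and a ratio of four Gamma functions. As a divided difference in
  disguise, the sum over \<open>i\<close> satisfies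
  $y\,S_m(P,Q) = S_{m-1}(P+1,Q) + S_{m-1}(P,Q-1)$, and so does, term by term, the terminating series
  $$W_k = {}_3F_2(-k,\,k+1,\,c;\,Q+2,\,1-P;\,1), \qquad c = 1 + 2a - \lambda - m/2,$$
  up to elementary factors; for \<open>m = 0\<close> both sides agree by Whipple's summation theorem. Neither
  \<open>c\<close> nor $(Q+2)+(1-P)$ depends on \<open>k\<close>.

  After exchanging the sums over \<open>k\<close> and over the index \<open>j\<close> of the series, the \<open>k\<close>-sum is the
  \<open>n\<close>-th divided difference, at the nodes $k(k+1)$, of a polynomial of degree \<open>n - 1\<close> in $k(k+1)$,
  hence zero for $j < n$. For $j = n$ only $k = n$ contributes, and this term is the right-hand side.
  The argument needs $P, Q \notin \mathbb{Z}$; both sides are continuous in \<open>a\<close>, so a small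
  perturbation of \<open>a\<close> gives the general case.
\<close>

section \<open>Non-integer arguments and small perturbations\<close>

lemma not_Int_shift: "(z::complex) \<notin> \<int> \<Longrightarrow> w - z \<in> \<int> \<Longrightarrow> w \<notin> \<int>"
  by (metis Ints_diff diff_diff_eq2 add_diff_cancel_left')

lemma not_Int_half:
  assumes "(z::complex) \<notin> \<int>" "2 * w - z \<in> \<int>" shows "w \<notin> \<int>"
  using assms by (metis Ints_diff Ints_mult Ints_numeral diff_diff_eq2 add_diff_cancel_left')

lemma not_Int_imp_not_nonpos: "(z::complex) \<notin> \<int> \<Longrightarrow> z \<notin> \<int>\<^sub>\<le>\<^sub>0"
  using nonpos_Ints_subset_Ints by auto

lemma Gamma_nonzero_of_not_Int: "(z::complex) \<notin> \<int> \<Longrightarrow> Gamma z \<noteq> 0"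
  by (simp add: Gamma_eq_zero_iff not_Int_imp_not_nonpos)

lemma pochhammer_nonzero_of_not_Int: "(z::complex) \<notin> \<int> \<Longrightarrow> pochhammer z j \<noteq> 0"
  by (metis pochhammer_eq_0_iff Ints_minus Ints_of_nat)

lemma not_Int_add_nat: "(z::complex) \<notin> \<int> \<Longrightarrow> z + of_nat j \<noteq> 0"
  by (metis Ints_minus Ints_of_nat eq_neg_iff_add_eq_0)

text \<open>Distinct integers are at distance at least 1, so distinct points \<open>t\<close> at
  which \<open>z + s * t\<close> is an integer are at least \<open>1 / norm s\<close> apart. This
  supplies the perturbation of \<open>a\<close> in the final continuity argument.\<close>

lemma eventually_not_Int:
  fixes z s a :: complex
  assumes "s \<noteq> 0"
  shows "eventually (\<lambda>t. z + s * t \<notin> \<int>) (at a)"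
proof (cases "z + s * a \<in> \<int>")
  case True
  have "z + s * t \<notin> \<int>" if "t \<noteq> a" "dist t a < 1 / norm s" for t
  proof
    assume "z + s * t \<in> \<int>"
    then have "(z + s * t) - (z + s * a) \<in> \<int>" using True by (rule Ints_diff)
    then obtain j where j: "s * (t - a) = of_int j"
      by (auto simp: Ints_def right_diff_distrib)
    have "norm (s * (t - a)) < 1"
      using that assms by (simp add: norm_mult dist_norm pos_less_divide_eq mult.commute)
    then have "j = 0" unfolding j by simp
    then show False using j that assms by simp
  qed
  then show ?thesis
    using assms unfolding eventually_at by (intro exI[of _ "1 / norm s"]) auto
next
  case False
  have "((\<lambda>t. z + s * t) \<longlongrightarrow> z + s * a) (at a)"
    by (intro tendsto_intros)
  moreover have "open (- \<int> :: complex set)"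
    by (simp add: open_Compl closed_Ints)
  ultimately show ?thesis
    using False topological_tendstoD by fastforce
qed

section \<open>Whipple's terminating series and its recurrence\<close>

text \<open>The \<open>j\<close>-th term of the 3F2 series at 1 with upper parameters
  \<open>- \<kappa>\<close>, \<open>\<kappa> + 1\<close>, \<open>c\<close> and lower parameters
  \<open>e\<close>, \<open>f\<close>. With a complex \<open>\<kappa>\<close> the neighbours
  \<open>\<kappa> - 1\<close> and \<open>\<kappa> + 1\<close> can be compared by plain
  algebra.\<close>

definition whipple_term :: "complex \<Rightarrow> complex \<Rightarrow> complex \<Rightarrow> complex \<Rightarrow> nat \<Rightarrow> complex" where
  "whipple_term \<kappa> c e f j = pochhammer (- \<kappa>) j * pochhammer (\<kappa> + 1) j * pochhammer c j
     / (fact j * pochhammer e j * pochhammer f j)"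

definition whipple_sum :: "nat \<Rightarrow> complex \<Rightarrow> complex \<Rightarrow> complex \<Rightarrow> complex" where
  "whipple_sum k c e f = (\<Sum>j\<le>k. whipple_term (of_nat k) c e f j)"

lemma whipple_term_eq_0: "k < j \<Longrightarrow> whipple_term (of_nat k) c e f j = 0"
  by (simp add: whipple_term_def pochhammer_of_nat_eq_0_iff)

lemma whipple_sum_extend: "k \<le> n \<Longrightarrow> whipple_sum k c e f = (\<Sum>j\<le>n. whipple_term (of_nat k) c e f j)"
  unfolding whipple_sum_def by (rule sum.mono_neutral_left) (auto intro: whipple_term_eq_0)

text \<open>
  A creative telescoping certificate: for $\kappa = k$ and $J > k$ the right-hand side vanishes,
  which leaves a two-term recurrence for Whipple's series with step 2 in \<open>k\<close>.
\<close>

lemma whipple_term_partial_sum: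
  assumes "e \<notin> \<int>" "f \<notin> \<int>" and ef: "e + f = 1 + 2 * c"
  shows "(\<Sum>j\<le>J. (e + \<kappa>) * (f + \<kappa>) * whipple_term (\<kappa> + 1) c e f j
            - (e - \<kappa> - 1) * (f - \<kappa> - 1) * whipple_term (\<kappa> - 1) c e f j)
         = 2 * (2 * \<kappa> + 1) * (c + of_nat J) * whipple_term \<kappa> c e f J"
proof (induction J)
  case 0
  have f: "f = 1 + 2 * c - e" using ef by (simp add: algebra_simps)
  show ?case by (simp add: whipple_term_def f) algebra
next
  case (Suc J)
  define A where "A = pochhammer (- \<kappa>) J"
  define B where "B = pochhammer (\<kappa> + 1) J"
  define C where "C = pochhammer c J"
  define E where "E = pochhammer e J"
  define F where "F = pochhammer f J"
  define x :: complex where "x = of_nat J"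
  define D where "D = A * B * C / (fact J * E * F)"
  have nz: "E \<noteq> 0" "F \<noteq> 0" "e + x \<noteq> 0" "f + x \<noteq> 0" "1 + x \<noteq> 0"
    using assms by (auto simp: E_def F_def x_def pochhammer_nonzero_of_not_Int not_Int_add_nat)
      (metis of_nat_Suc of_nat_neq_0)
  \<comment> \<open>The shift of \<open>\<kappa>\<close> gives one Pochhammer symbol a factor
    \<open>\<kappa> + 1\<close> and takes the same factor from the other. Treating the product of
    both avoids a division by \<open>\<kappa> + 1\<close>, which may be zero; \<open>down\<close>
    does the same with \<open>\<kappa>\<close>.\<close>
  have up: "pochhammer (- (\<kappa> + 1)) (Suc J) * pochhammer (\<kappa> + 1 + 1) (Suc J)
      = - (A * B * (\<kappa> + 1 + x) * (\<kappa> + 2 + x))"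
  proof -
    have "pochhammer (- (\<kappa> + 1)) (Suc J) = - (\<kappa> + 1) * A"
      by (simp add: pochhammer_rec A_def)
    moreover have "(\<kappa> + 1) * pochhammer (\<kappa> + 1 + 1) (Suc J) = pochhammer (\<kappa> + 1) (Suc (Suc J))"
      by (simp only: pochhammer_rec[of "\<kappa> + 1" "Suc J"])
    moreover have "\<dots> = B * (\<kappa> + 1 + x) * (\<kappa> + 2 + x)"
      by (simp add: pochhammer_Suc B_def x_def add_ac)
    ultimately show ?thesis by algebra
  qed
  have down: "pochhammer (- (\<kappa> - 1)) (Suc J) * pochhammer (\<kappa> - 1 + 1) (Suc J)
      = - (A * B * (x - \<kappa>) * (x + 1 - \<kappa>))"
  proof -
    have "pochhammer (\<kappa> - 1 + 1) (Suc J) = \<kappa> * B"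
      by (simp add: pochhammer_rec B_def)
    moreover have "- \<kappa> * pochhammer (- (\<kappa> - 1)) (Suc J) = pochhammer (- \<kappa>) (Suc (Suc J))"
      by (simp add: pochhammer_rec[of "- \<kappa>" "Suc J"])
    moreover have "\<dots> = A * (x - \<kappa>) * (x + 1 - \<kappa>)"
      by (simp add: pochhammer_Suc A_def x_def algebra_simps)
    ultimately show ?thesis by algebra
  qed
  have q: "fact (Suc J) * pochhammer e (Suc J) * pochhammer f (Suc J)
      = (fact J * E * F) * ((1 + x) * (e + x) * (f + x))"
    by (simp add: pochhammer_Suc E_def F_def x_def)
  have C1: "pochhammer c (Suc J) = C * (c + x)"
    by (simp add: pochhammer_Suc C_def x_def)
  \<comment> \<open>All terms of the induction step are polynomial multiples of \<open>R\<close>, so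
    that a polynomial identity remains once \<open>f\<close> is eliminated through
    \<open>ef\<close>.\<close>
  define R where "R = (c + x) * D / ((1 + x) * (e + x) * (f + x))"
  have t1: "whipple_term (\<kappa> + 1) c e f (Suc J) = - ((\<kappa> + 1 + x) * (\<kappa> + 2 + x)) * R"
    unfolding whipple_term_def up q C1 R_def D_def by (simp add: field_simps)
  have t2: "whipple_term (\<kappa> - 1) c e f (Suc J) = - ((x - \<kappa>) * (x + 1 - \<kappa>)) * R"
    unfolding whipple_term_def down q C1 R_def D_def by (simp add: field_simps)
  have t3: "whipple_term \<kappa> c e f (Suc J) = (x - \<kappa>) * (\<kappa> + 1 + x) * R"
  proof -
    have "pochhammer (- \<kappa>) (Suc J) * pochhammer (\<kappa> + 1) (Suc J) = A * B * ((x - \<kappa>) * (\<kappa> + 1 + x))"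
      by (simp add: pochhammer_Suc A_def B_def x_def)
    then have "whipple_term \<kappa> c e f (Suc J) = A * B * ((x - \<kappa>) * (\<kappa> + 1 + x)) * (C * (c + x))
        / ((fact J * E * F) * ((1 + x) * (e + x) * (f + x)))"
      unfolding whipple_term_def q C1 by simp
    then show ?thesis unfolding R_def D_def by (simp add: field_simps)
  qed
  have t4: "(c + x) * whipple_term \<kappa> c e f J = (1 + x) * (e + x) * (f + x) * R"
    using nz by (simp add: whipple_term_def R_def D_def A_def B_def C_def E_def F_def)
  have sx: "of_nat (Suc J) = x + 1" by (simp add: x_def)
  have f: "f = 1 + 2 * c - e" using ef by (simp add: algebra_simps)
  have "2 * (2 * \<kappa> + 1) * (c + x) * whipple_term \<kappa> c e f J
     = 2 * (2 * \<kappa> + 1) * ((1 + x) * (e + x) * (f + x) * R)"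
    using t4 by algebra
  then show ?case
    unfolding sum.atMost_Suc Suc.IH x_def[symmetric] t1 t2 t3 sx unfolding f by algebra
qed

lemma whipple_sum_rec:
  assumes "e \<notin> \<int>" "f \<notin> \<int>" "e + f = 1 + 2 * c"
  shows "(e + of_nat k + 1) * (f + of_nat k + 1) * whipple_sum (Suc (Suc k)) c e f
    = (e - of_nat k - 2) * (f - of_nat k - 2) * whipple_sum k c e f"
proof -
  \<comment> \<open>The certificate is centred at \<open>k + 1\<close>, halfway between the two
    series. The bound \<open>J = k + 2\<close> covers all terms of the longer one and exceeds
    \<open>\<kappa>\<close>, which makes the right-hand side vanish.\<close>
  define \<kappa> :: complex where "\<kappa> = of_nat (Suc k)"
  have s: "whipple_sum (Suc (Suc k)) c e f = sum (whipple_term (\<kappa> + 1) c e f) {..Suc (Suc k)}"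
    unfolding whipple_sum_def \<kappa>_def by (simp only: of_nat_Suc add_ac)
  have s': "whipple_sum k c e f = sum (whipple_term (\<kappa> - 1) c e f) {..Suc (Suc k)}"
    using whipple_sum_extend[of k "Suc (Suc k)"] by (simp add: \<kappa>_def)
  have "whipple_term \<kappa> c e f (Suc (Suc k)) = 0"
    unfolding \<kappa>_def by (rule whipple_term_eq_0) simp
  then have "(e + \<kappa>) * (f + \<kappa>) * whipple_sum (Suc (Suc k)) c e f
      - (e - \<kappa> - 1) * (f - \<kappa> - 1) * whipple_sum k c e f = 0"
    using whipple_term_partial_sum[OF assms, where J = "Suc (Suc k)" and \<kappa> = \<kappa>]
    unfolding s s' sum_subtractf sum_distrib_left by simp
  then show ?thesis by (simp add: \<kappa>_def algebra_simps)
qed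

section \<open>Whipple's summation theorem\<close>

text \<open>The Gamma factors of the summand that contain both \<open>i\<close> and
  \<open>a\<close>. In the variables \<open>P\<close> and \<open>Q\<close>, raising \<open>m\<close>
  alone amounts to \<open>P + 1\<close>, and raising \<open>m\<close> and \<open>i\<close> together
  amounts to \<open>Q - 1\<close>; the induction on \<open>m\<close> rests on this.\<close>

definition gamma_ratio :: "nat \<Rightarrow> nat \<Rightarrow> nat \<Rightarrow> complex \<Rightarrow> complex \<Rightarrow> complex" where
  "gamma_ratio k m i P Q =
     Gamma ((P - of_nat k + of_nat m - of_nat i) / 2) * Gamma ((P + of_nat k + 1 + of_nat m - of_nat i) / 2)
     / (Gamma ((Q - of_nat k + 2 - of_nat i) / 2) * Gamma ((Q + of_nat k + 3 - of_nat i) / 2))"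

lemma Gamma_half_shift:
  assumes "(z::complex) \<notin> \<int>"
  shows "Gamma ((z + 2) / 2) = z / 2 * Gamma (z / 2)"
proof -
  have "z / 2 \<notin> \<int>\<^sub>\<le>\<^sub>0"
    by (rule not_Int_imp_not_nonpos, rule not_Int_half[OF assms]) simp
  from Gamma_plus1[OF this] show ?thesis by (simp add: add_divide_distrib)
qed

text \<open>Legendre's duplication formula for the argument \<open>z / 2\<close>.\<close>

lemma Gamma_half_mult:
  assumes "(z::complex) \<notin> \<int>"
  shows "Gamma (z / 2) * Gamma ((z + 1) / 2) = 2 powr (1 - z) * of_real (sqrt pi) * Gamma z"
proof -
  have *: "z / 2 \<notin> \<int>" "z / 2 + 1 / 2 \<notin> \<int>"
    by (rule not_Int_half[OF assms], simp)+
  have "Gamma (z / 2) * Gamma (z / 2 + 1 / 2)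
     = exp ((1 - 2 * (z / 2)) * of_real (ln 2)) * of_real (sqrt pi) * Gamma (2 * (z / 2))"
    using * by (intro Gamma_legendre_duplication not_Int_imp_not_nonpos)
  also have "exp ((1 - 2 * (z / 2)) * of_real (ln 2)) = (2::complex) powr (1 - z)"
    using Ln_of_real[of 2] by (simp add: powr_def)
  finally show ?thesis by (simp add: add_divide_distrib)
qed

text \<open>Whipple's theorem: the lower parameters \<open>Q + 2\<close> and \<open>1 - P\<close>
  add up to \<open>1 + 2 * c\<close>. Both sides obey the same recurrence of step 2 in
  \<open>k\<close>, so it suffices to check \<open>k = 0\<close>, by duplication, and
  \<open>k = 1\<close>.\<close>

lemma gamma_ratio_0_whipple_sum:
  assumes P: "P \<notin> \<int>" and Q: "Q \<notin> \<int>"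
  shows "gamma_ratio k 0 0 P Q = 2 powr (2 + Q - P) * Gamma P / Gamma (Q + 2)
           * whipple_sum k (1 + (Q - P) / 2) (Q + 2) (1 - P)"
proof -
  have n: "Q + 2 \<notin> \<int>" using assms(2) by (rule not_Int_shift) simp
  have "gamma_ratio 0 0 0 P Q = (Gamma (P / 2) * Gamma ((P + 1) / 2))
      / (Gamma ((Q + 2) / 2) * Gamma ((Q + 2 + 1) / 2))"
    by (simp add: gamma_ratio_def add.assoc)
  also have "\<dots> = 2 powr (1 - P) / 2 powr (1 - (Q + 2)) * Gamma P / Gamma (Q + 2)"
    unfolding Gamma_half_mult[OF assms(1)] Gamma_half_mult[OF n] by simp
  also have "2 powr (1 - P) / 2 powr (1 - (Q + 2)) = (2::complex) powr (2 + Q - P)"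
    unfolding powr_diff[symmetric] by (simp add: algebra_simps)
  finally have zero: "gamma_ratio 0 0 0 P Q = 2 powr (2 + Q - P) * Gamma P / Gamma (Q + 2)" .
  show ?thesis
  proof (induction k rule: induct_nat_012)
    case 0
    show ?case by (simp add: zero whipple_sum_def whipple_term_def)
  next
    case 1
    have n: "Q + 2 \<notin> \<int>" "P - 1 \<notin> \<int>" "Q + 1 \<notin> \<int>"
      by (rule not_Int_shift[OF Q], simp) (rule not_Int_shift[OF P], simp, rule not_Int_shift[OF Q], simp)
    have nz: "P \<noteq> 0" "Q + 2 \<noteq> 0" "P - 1 \<noteq> 0" "Q + 1 \<noteq> 0"
      using P Q n by (metis Ints_0)+
    have w: "whipple_sum (Suc 0) (1 + (Q - P) / 2) (Q + 2) (1 - P) = (Q + 1) * P / ((Q + 2) * (P - 1))"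
    proof -
      have "whipple_sum (Suc 0) (1 + (Q - P) / 2) (Q + 2) (1 - P)
          = 1 + (2 + Q - P) / ((Q + 2) * (P - 1))"
        using nz by (simp add: whipple_sum_def whipple_term_def divide_simps) algebra
      also have "\<dots> = (Q + 1) * P / ((Q + 2) * (P - 1))"
        using nz by (simp add: divide_simps) algebra
      finally show ?thesis .
    qed
    \<comment> \<open>The functional equation at \<open>P - 1\<close>, \<open>P\<close>,
      \<open>Q + 1\<close> and \<open>Q + 2\<close> carries the four Gamma values for
      \<open>k = 1\<close> to those for \<open>k = 0\<close>.\<close>
    have p: "(P - 1 + 2) / 2 = (P + 1) / 2" "(Q + 1 + 2) / 2 = (Q + 2 + 1) / 2" by simp_all
    have "gamma_ratio (Suc 0) 0 0 P Q = Gamma ((P - 1) / 2) * Gamma ((P + 2) / 2)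
        / (Gamma ((Q + 1) / 2) * Gamma ((Q + 2 + 2) / 2))"
      by (simp add: gamma_ratio_def add.commute)
    also have "\<dots> = (Gamma (P / 2) * Gamma ((P + 1) / 2))
        / (Gamma ((Q + 2) / 2) * Gamma ((Q + 2 + 1) / 2)) * ((Q + 1) * P / ((Q + 2) * (P - 1)))"
    proof -
      have gP: "Gamma ((P + 1) / 2) = (P - 1) / 2 * Gamma ((P - 1) / 2)"
        using Gamma_half_shift[OF n(2)] p(1) by metis
      have gQ: "Gamma ((Q + 2 + 1) / 2) = (Q + 1) / 2 * Gamma ((Q + 1) / 2)"
        using Gamma_half_shift[OF n(3)] p(2) by metis
      show ?thesis
        unfolding Gamma_half_shift[OF n(1)] Gamma_half_shift[OF P] gP gQ using nz by (simp add: mult_ac)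
    qed
    also have "(Gamma (P / 2) * Gamma ((P + 1) / 2))
        / (Gamma ((Q + 2) / 2) * Gamma ((Q + 2 + 1) / 2)) = gamma_ratio 0 0 0 P Q"
      by (simp add: gamma_ratio_def add.assoc)
    finally show ?case unfolding w zero by simp
  next
    case (ge2 k)
    define K :: complex where "K = of_nat k"
    have KI: "K \<in> \<int>" by (simp add: K_def)
    have nP: "P - K - 2 \<notin> \<int>" "P + K + 1 \<notin> \<int>"
      by (rule not_Int_shift[OF P], simp add: KI)+
    have nm: "1 - P \<notin> \<int>"
      using P by (metis Ints_1 Ints_diff diff_diff_eq2 add_diff_cancel_left')
    have nQ: "Q - K \<notin> \<int>" "Q + K + 3 \<notin> \<int>" "Q + 2 \<notin> \<int>"
      by (rule not_Int_shift[OF Q], simp add: KI)+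
    have nz: "P - K - 2 \<noteq> 0" "P + K + 1 \<noteq> 0" "Q - K \<noteq> 0" "Q + K + 3 \<noteq> 0"
      using nP nQ by (metis Ints_0)+
    \<comment> \<open>From \<open>k\<close> to \<open>k + 2\<close> one argument in the numerator
      and one in the denominator drop by 1, and the other two rise by 1. The resulting rational
      factor is the one in \<open>whipple_sum_rec\<close>.\<close>
    have "gamma_ratio (Suc (Suc k)) 0 0 P Q = Gamma ((P - K - 2) / 2) * Gamma ((P + K + 1 + 2) / 2)
        / (Gamma ((Q - K) / 2) * Gamma ((Q + K + 3 + 2) / 2))"
      by (simp add: gamma_ratio_def K_def algebra_simps)
    also have "\<dots> = (P + K + 1) * (Q - K) / ((P - K - 2) * (Q + K + 3)) * gamma_ratio k 0 0 P Q"
    proof -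
      have "gamma_ratio k 0 0 P Q = Gamma ((P - K - 2 + 2) / 2) * Gamma ((P + K + 1) / 2)
        / (Gamma ((Q - K + 2) / 2) * Gamma ((Q + K + 3) / 2))"
        by (simp add: gamma_ratio_def K_def)
      then show ?thesis
        unfolding Gamma_half_shift[OF nP(1)] Gamma_half_shift[OF nP(2)]
          Gamma_half_shift[OF nQ(1)] Gamma_half_shift[OF nQ(2)]
        using nz by (simp add: mult_ac)
    qed
    finally have g: "gamma_ratio (Suc (Suc k)) 0 0 P Q = \<dots>" .
    let ?W = "\<lambda>k. whipple_sum k (1 + (Q - P) / 2) (Q + 2) (1 - P)"
    have "(Q + 2 + K + 1) * (1 - P + K + 1) * ?W (Suc (Suc k)) = (Q + 2 - K - 2) * (1 - P - K - 2) * ?W k"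
      unfolding K_def by (rule whipple_sum_rec[OF nQ(3) nm]) simp
    then have "(P - K - 2) * (Q + K + 3) * ?W (Suc (Suc k)) = (P + K + 1) * (Q - K) * ?W k"
      by algebra
    then have "?W (Suc (Suc k)) = (P + K + 1) * (Q - K) / ((P - K - 2) * (Q + K + 3)) * ?W k"
      using nz by (simp add: nonzero_eq_divide_eq mult_ac)
    then show ?case unfolding g ge2(1) by (simp add: mult_ac)
  qed
qed

section \<open>The contiguous relation and the sum over \<open>i\<close>\<close>

text \<open>By \<open>shift\<close>, the two products on the left are the term for \<open>e\<close>,
  \<open>f\<close> multiplied by \<open>e - 1 + j\<close> and by \<open>f - 1 + j\<close>; the
  difference of these factors does not involve \<open>j\<close>, so the relation passes to
  sums.\<close>

lemma whipple_term_contiguous: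
  assumes "e \<notin> \<int>" "f \<notin> \<int>"
  shows "(e - 1) * whipple_term \<kappa> c (e - 1) f j - (f - 1) * whipple_term \<kappa> c e (f - 1) j = (e - f) * whipple_term \<kappa> c e f j"
proof -
  have shift: "(z - 1) / pochhammer (z - 1) j = (z - 1 + of_nat j) / pochhammer z j"
    if "z \<notin> \<int>" for z :: complex
  proof -
    have "z - 1 \<notin> \<int>" using that by (rule not_Int_shift) simp
    then have "pochhammer (z - 1) j \<noteq> 0" "pochhammer z j \<noteq> 0"
      using that by (simp_all add: pochhammer_nonzero_of_not_Int)
    moreover have "(z - 1) * pochhammer z j = pochhammer (z - 1) j * (z - 1 + of_nat j)"
      using pochhammer_rec[of "z - 1" j] by (simp add: pochhammer_Suc)
    ultimately show ?thesis by (simp add: divide_simps mult_ac)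
  qed
  define A where "A = pochhammer (- \<kappa>) j * pochhammer (\<kappa> + 1) j * pochhammer c j / fact j"
  have w: "whipple_term \<kappa> c e f j = A / (pochhammer e j * pochhammer f j)" for e f
    by (simp add: whipple_term_def A_def)
  have "(e - 1) * whipple_term \<kappa> c (e - 1) f j = A / pochhammer f j * ((e - 1) / pochhammer (e - 1) j)"
    unfolding w by (simp add: mult_ac)
  moreover have "(f - 1) * whipple_term \<kappa> c e (f - 1) j = A / pochhammer e j * ((f - 1) / pochhammer (f - 1) j)"
    unfolding w by (simp add: mult_ac)
  ultimately show ?thesis
    unfolding shift[OF assms(1)] shift[OF assms(2)] unfolding w
    by (simp add: diff_divide_distrib[symmetric] algebra_simps)
qed

text \<open>Induction on \<open>m\<close>: times \<open>P + Q + 1\<close>, the sum for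
  \<open>m + 1\<close> at \<open>(P, Q)\<close> splits into the sums for \<open>m\<close> at
  \<open>(P + 1, Q)\<close> and \<open>(P, Q - 1)\<close>. Either shift moves
  \<open>P + Q + 1\<close> by 1, hence the bound \<open>m\<close> on \<open>j\<close> in the
  nonvanishing hypothesis.\<close>

lemma gamma_ratio_sum:
  assumes "P \<notin> \<int>" "Q \<notin> \<int>" "\<And>j. \<bar>j\<bar> \<le> int m \<Longrightarrow> P + Q + 1 + of_int j \<noteq> 0"
  shows "(\<Sum>i\<le>m. of_nat (m choose i) * (P + Q + 1 + of_nat m - 2 * of_nat i)
            / pochhammer (P + Q + 1 - of_nat i) (Suc m) * gamma_ratio k m i P Q)
      = 2 powr (2 + Q - P) / 2 ^ m * Gamma P / Gamma (Q + 2)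
           * whipple_sum k (1 + (Q - P - of_nat m) / 2) (Q + 2) (1 - P)"
  using assms
proof (induction m arbitrary: P Q)
  case 0
  then show ?case using 0(3)[of 0] by (simp add: gamma_ratio_0_whipple_sum)
next
  case (Suc m)
  define y where "y = P + Q + 1"
  have y: "y + of_int j \<noteq> 0" if "\<bar>j\<bar> \<le> int (Suc m)" for j
    using Suc.prems(3)[OF that] by (simp add: y_def)
  have y0: "y \<noteq> 0" using y[of 0] by simp
  \<comment> \<open>Up to \<open>fact m\<close> and the sign \<open>(-1) ^ i\<close>, these are the
    weights of the divided difference at the nodes \<open>i * (i - z - m)\<close> for
    \<open>i \<le> m\<close>.\<close>
  define co where "co = (\<lambda>m z i. of_nat (m choose i) * (z + of_nat m - 2 * of_nat i)
            / pochhammer (z - of_nat i) (Suc m) :: complex)"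
  have co0: "y * co (Suc m) y 0 = co m (y + 1) 0"
    using y[of 0] by (simp add: co_def pochhammer_rec[of y "Suc m"] add_ac)
  have co_Suc: "y * co (Suc m) y (Suc i) = co m (y + 1) (Suc i) + co m (y - 1) i" if i: "i \<le> m" for i
  proof -
    \<comment> \<open>The three weights have the same numerator \<open>N\<close> and their
      Pochhammer symbols share the factor \<open>X\<close>. What is left is the weighted Pascal rule
      \<open>b\<close>.\<close>
    define z where "z = y - of_nat (Suc i)"
    define X where "X = pochhammer (z + 1) m"
    define N where "N = y + of_nat (Suc m) - 2 * of_nat (Suc i)"
    have nz: "z \<noteq> 0" "z + 1 + of_nat m \<noteq> 0"
      using i y[of "- int (Suc i)"] y[of "int m - int i"] by (simp_all add: z_def diff_diff_eq algebra_simps)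
    have p1: "pochhammer (y - of_nat (Suc i)) (Suc (Suc m)) = z * X * (z + 1 + of_nat m)"
      unfolding z_def[symmetric] pochhammer_rec[of z "Suc m"] pochhammer_Suc[of "z + 1" m] X_def by simp
    have p2: "pochhammer (y + 1 - of_nat (Suc i)) (Suc m) = X * (z + 1 + of_nat m)"
      by (simp add: z_def X_def pochhammer_Suc algebra_simps)
    have p3: "pochhammer (y - 1 - of_nat i) (Suc m) = z * X"
      by (simp add: z_def X_def pochhammer_rec algebra_simps)
    have n2: "y + 1 + of_nat m - 2 * of_nat (Suc i) = N" "y - 1 + of_nat m - 2 * of_nat i = N"
      by (simp_all add: N_def)
    have "Suc i * (m choose Suc i) = (m - i) * (m choose i)"
      by (metis binomial_absorb_comp binomial_absorption)
    from this[THEN arg_cong[where f = "of_nat :: nat \<Rightarrow> complex"]]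
    have "(1 + of_nat i) * of_nat (m choose Suc i) = (of_nat m - of_nat i) * (of_nat (m choose i) :: complex)"
      using i by (simp only: of_nat_mult of_nat_Suc of_nat_diff)
    then have b: "y * of_nat (Suc m choose Suc i)
        = of_nat (m choose Suc i) * z + of_nat (m choose i) * (z + 1 + of_nat m)"
      by (simp add: z_def algebra_simps)
    have "y * co (Suc m) y (Suc i) = (y * of_nat (Suc m choose Suc i)) * (N / X) / (z * (z + 1 + of_nat m))"
      unfolding co_def p1 N_def[symmetric] by (simp del: binomial_Suc_Suc add: mult_ac)
    also have "\<dots> = of_nat (m choose Suc i) * (N / X) / (z + 1 + of_nat m) + of_nat (m choose i) * (N / X) / z"
      unfolding b using nz by (simp add: divide_simps) (simp add: algebra_simps)
    also have "\<dots> = co m (y + 1) (Suc i) + co m (y - 1) i"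
      unfolding co_def p2 p3 n2 by (simp add: mult_ac)
    finally show ?thesis .
  qed
  have g1: "gamma_ratio k (Suc m) i P Q = gamma_ratio k m i (P + 1) Q" for i
    by (simp add: gamma_ratio_def algebra_simps)
  have g2: "gamma_ratio k (Suc m) (Suc i) P Q = gamma_ratio k m i P (Q - 1)" for i
    by (simp add: gamma_ratio_def algebra_simps)
  let ?c = "1 + (Q - P - of_nat (Suc m)) / 2"
  let ?F = "2 powr (2 + Q - P) / 2 ^ Suc m * Gamma P / Gamma (Q + 2)"
  have n: "P + 1 \<notin> \<int>" "Q - 1 \<notin> \<int>" "Q + 1 \<notin> \<int>" "Q + 2 \<notin> \<int>"
    by (rule not_Int_shift[OF Suc.prems(1)], simp) (rule not_Int_shift[OF Suc.prems(2)], simp)+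
  have nm: "1 - P \<notin> \<int>"
    using Suc.prems(1) by (metis Ints_1 Ints_diff diff_diff_eq2 add_diff_cancel_left')
  have GP: "Gamma (P + 1) = P * Gamma P"
    using Suc.prems(1) by (intro Gamma_plus1 not_Int_imp_not_nonpos)
  have GQ: "Gamma (Q + 2) = (Q + 1) * Gamma (Q + 1)"
    using Gamma_plus1[OF not_Int_imp_not_nonpos[OF n(3)]] by (simp add: add.assoc)
  have pw: "2 powr (2 + Q - P - 1) = 2 powr (2 + Q - P) / (2 :: complex)"
    using powr_diff[of "2 :: complex" "2 + Q - P" 1] by simp
  have "P + 1 + Q + 1 + of_int j \<noteq> 0" if "\<bar>j\<bar> \<le> int m" for j
  proof -
    have pw: "2 powr (2 + Q - P - 1) = 2 powr (2 + Q - P) / (2 :: complex)"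
    using powr_diff[of "2 :: complex" "2 + Q - P" 1] by simp
  have "P + 1 + Q + 1 + of_int j = y + of_int (j + 1)" by (simp add: y_def)
    moreover have "\<bar>j + 1\<bar> \<le> int (Suc m)" using that by linarith
    ultimately show ?thesis using y by metis
  qed
  note * = Suc.IH[OF n(1) Suc.prems(2) this]
  have eq: "P + 1 + Q + 1 = y + 1" "2 + Q - (P + 1) = (2 + Q - P) - 1" "1 - (P + 1) = - P"
       "1 + (Q - (P + 1) - of_nat m) / 2 = ?c" by (simp_all add: y_def algebra_simps)
  have 1: "(\<Sum>i\<le>m. co m (y + 1) i * gamma_ratio k m i (P + 1) Q) = ?F * (P * whipple_sum k ?c (Q + 2) (- P))"
    unfolding co_def using *[unfolded eq pw GP] by (simp add: mult_ac)
  have "P + (Q - 1) + 1 + of_int j \<noteq> 0" if "\<bar>j\<bar> \<le> int m" for j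
  proof -
    have "P + (Q - 1) + 1 + of_int j = y + of_int (j - 1)" by (simp add: y_def)
    moreover have "\<bar>j - 1\<bar> \<le> int (Suc m)" using that by linarith
    ultimately show ?thesis using y by metis
  qed
  note * = Suc.IH[OF Suc.prems(1) n(2) this]
  have eq: "P + (Q - 1) + 1 = y - 1" "2 + (Q - 1) - P = (2 + Q - P) - 1" "Q - 1 + 2 = Q + 1"
       "1 + (Q - 1 - P - of_nat m) / 2 = ?c" by (simp_all add: y_def algebra_simps)
  have "Gamma (Q + 1) \<noteq> 0" "Q + 1 \<noteq> 0"
    using n(3) Gamma_nonzero_of_not_Int by (metis, metis Ints_0)
  then have 2: "(\<Sum>i\<le>m. co m (y - 1) i * gamma_ratio k m i P (Q - 1)) = ?F * ((Q + 1) * whipple_sum k ?c (Q + 1) (1 - P))"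
    unfolding co_def GQ using *[unfolded eq pw] by (simp add: mult_ac)
  \<comment> \<open>The contiguous relation at \<open>e = Q + 2\<close> and
    \<open>f = 1 - P\<close>, where \<open>e - f = y\<close>. The parameter \<open>?c\<close> is the
    same in all three series.\<close>
  have contig: "(Q + 1) * whipple_sum k ?c (Q + 1) (1 - P) + P * whipple_sum k ?c (Q + 2) (- P) = y * whipple_sum k ?c (Q + 2) (1 - P)"
  proof -
    have "(Q + 1) * whipple_term \<kappa> ?c (Q + 1) (1 - P) j + P * whipple_term \<kappa> ?c (Q + 2) (- P) j
       = y * whipple_term \<kappa> ?c (Q + 2) (1 - P) j" for \<kappa> j
      using whipple_term_contiguous[OF n(4) nm, of \<kappa> ?c j] by (simp add: y_def algebra_simps)
    then show ?thesis unfolding whipple_sum_def by (simp add: sum_distrib_left sum.distrib[symmetric])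
  qed
  have "y * (\<Sum>i\<le>Suc m. co (Suc m) y i * gamma_ratio k (Suc m) i P Q)
    = (\<Sum>i\<le>Suc m. y * co (Suc m) y i * gamma_ratio k (Suc m) i P Q)"
    by (simp only: sum_distrib_left mult.assoc)
  also have "\<dots> = co m (y + 1) 0 * gamma_ratio k (Suc m) 0 P Q
     + (\<Sum>i\<le>m. (co m (y + 1) (Suc i) + co m (y - 1) i) * gamma_ratio k (Suc m) (Suc i) P Q)"
    unfolding sum.atMost_Suc_shift co0 by (simp add: co_Suc del: of_nat_Suc)
  \<comment> \<open>The first of the two sums runs up to \<open>m + 1\<close>; its last term is zero
    because \<open>m choose Suc m\<close> is.\<close>
  also have "\<dots> = (\<Sum>i\<le>Suc m. co m (y + 1) i * gamma_ratio k (Suc m) i P Q)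
     + (\<Sum>i\<le>m. co m (y - 1) i * gamma_ratio k (Suc m) (Suc i) P Q)"
    unfolding sum.atMost_Suc_shift by (simp add: distrib_right sum.distrib)
  also have "(\<Sum>i\<le>Suc m. co m (y + 1) i * gamma_ratio k (Suc m) i P Q)
     = (\<Sum>i\<le>m. co m (y + 1) i * gamma_ratio k m i (P + 1) Q)"
    by (simp add: g1) (simp add: co_def)
  also have "(\<Sum>i\<le>m. co m (y - 1) i * gamma_ratio k (Suc m) (Suc i) P Q)
     = (\<Sum>i\<le>m. co m (y - 1) i * gamma_ratio k m i P (Q - 1))"
    by (simp only: g2)
  also have "(\<Sum>i\<le>m. co m (y + 1) i * gamma_ratio k m i (P + 1) Q)
      + (\<Sum>i\<le>m. co m (y - 1) i * gamma_ratio k m i P (Q - 1)) = y * (?F * whipple_sum k ?c (Q + 2) (1 - P))"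
  proof -
    have "F * (p * a) + F * (q * b) = y * (F * W)" if "q * b + p * a = y * W" for F p q a b W
      using that by algebra
    from this[OF contig] show ?thesis unfolding 1 2 .
  qed
  finally have "(\<Sum>i\<le>Suc m. co (Suc m) y i * gamma_ratio k (Suc m) i P Q) = ?F * whipple_sum k ?c (Q + 2) (1 - P)"
    by (simp only: mult_left_cancel[OF y0])
  then show ?case unfolding co_def y_def .
qed

section \<open>Divided differences at the nodes \<open>k * (k + 1)\<close>\<close>

text \<open>Multiplied by \<open>n\<close>, each summand is a difference of consecutive values of
  the closed form, so the sum telescopes. The case \<open>k = n\<close> shows, for positive
  \<open>n\<close>, that the terms below the last one add up to minus the last.\<close>

lemma well_poised_sum_one:
  assumes "k \<le> n"
  shows "of_nat n * (\<Sum>j<k. (-1) ^ j * (2 * of_nat j + 1) / (fact (n - j) * fact (n + j + 1)))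
     = (- ((-1) ^ k * of_nat k / (fact (n - k) * fact (n + k))) :: complex)"
  using assms
proof (induction k)
  case (Suc k)
  then obtain d where d: "n = Suc (k + d)" by (metis Suc_le_eq less_iff_Suc_add)
  define x y :: complex where "x = of_nat k" and "y = of_nat d"
  define u :: complex where "u = (-1) ^ k / (fact (Suc d) * fact (n + k + 1))"
  have nz: "1 + y \<noteq> 0" "2 + 2 * x + y \<noteq> 0"
    using of_nat_neq_0[of d, where 'a = complex] of_nat_neq_0[of "2 * k + d + 1", where 'a = complex]
    by (simp_all add: x_def y_def algebra_simps)
  have f: "fact (Suc d) = (1 + y) * (fact d :: complex)"
     "fact (n + k + 1) = (2 + 2 * x + y) * (fact (n + k) :: complex)"
    by (simp_all add: d x_def y_def algebra_simps)
  have nat: "n - k = Suc d" "n - Suc k = d" "n + Suc k = n + k + 1"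
    by (simp_all add: d)
  have 1: "(-1) ^ k * of_nat k / (fact (n - k) * fact (n + k)) = x * (2 + 2 * x + y) * u"
    unfolding u_def nat f x_def[symmetric] using nz by (simp add: mult_ac)
  have 2: "(-1) ^ Suc k * of_nat (Suc k) / (fact (n - Suc k) * fact (n + Suc k)) = - ((x + 1) * (1 + y) * u)"
    unfolding u_def nat f of_nat_Suc x_def[symmetric] using nz
    by (simp add: mult_ac add_ac)
  have 3: "(-1) ^ k * (2 * of_nat k + 1) / (fact (n - k) * fact (n + k + 1)) = (2 * x + 1) * u"
    unfolding u_def nat x_def[symmetric] by simp
  have 4: "of_nat n = x + y + 1"
    by (simp add: d x_def y_def)
  have IH: "of_nat n * (\<Sum>j<k. (-1) ^ j * (2 * of_nat j + 1) / (fact (n - j) * fact (n + j + 1)))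
     = - (x * (2 + 2 * x + y) * u)"
    using Suc unfolding 1 by simp
  show ?case
    unfolding sum.lessThan_Suc distrib_left[of "of_nat n :: complex"] IH 2 3 unfolding 4 by algebra
qed simp

text \<open>
  With nodes $x_k = k(k+1)$ the weight of \<open>k\<close> is $(-1)^n / \prod_{r \ne k} (x_k - x_r)$; this is
  why the sum annihilates products of fewer than \<open>n\<close> linear factors in $x_k$.
\<close>

lemma well_poised_sum_linear_factors:
  fixes \<alpha> \<beta> :: "nat \<Rightarrow> complex"
  assumes "N < n"
  shows "(\<Sum>k\<le>n. (-1) ^ k * (2 * of_nat k + 1) / (fact (n - k) * fact (n + k + 1))
            * (\<Prod>r<N. \<alpha> r + \<beta> r * (of_nat k * (of_nat k + 1)))) = 0"
  using assms
proof (induction N arbitrary: n)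
  case 0
  have "(\<Sum>k\<le>n. (-1) ^ k * (2 * of_nat k + 1) / (fact (n - k) * fact (n + k + 1)))
     = (\<Sum>k<n. (-1) ^ k * (2 * of_nat k + 1) / (fact (n - k) * fact (n + k + 1)))
       + (-1) ^ n * (2 * of_nat n + 1) / (fact (2 * n + 1) :: complex)"
    unfolding lessThan_Suc_atMost[symmetric] sum.lessThan_Suc by (simp flip: mult_2)
  also have "(-1) ^ n * (2 * of_nat n + 1) / fact (2 * n + 1) = ((-1) ^ n / fact (2 * n) :: complex)"
  proof -
    have "fact (2 * n + 1) = (2 * of_nat n + 1) * (fact (2 * n) :: complex)"
      by (simp add: add_ac)
    moreover have "2 * of_nat n + 1 \<noteq> (0 :: complex)"
      using of_nat_neq_0[of "2 * n", where 'a = complex] by (simp add: add_ac)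
    ultimately show ?thesis by (simp only: divide_divide_eq_left[symmetric]) simp
  qed
  also have "(\<Sum>k<n. (-1) ^ k * (2 * of_nat k + 1) / (fact (n - k) * fact (n + k + 1)))
     = - ((-1) ^ n / fact (2 * n) :: complex)"
    (is "?S = _")
  proof -
    have "of_nat n * ?S = of_nat n * (- ((-1) ^ n / fact (2 * n)))"
      unfolding well_poised_sum_one[OF order_refl] by (simp flip: mult_2)
    moreover have "of_nat n \<noteq> (0 :: complex)" using 0 by simp
    ultimately show ?thesis by (simp only: mult_left_cancel not_False_eq_True)
  qed
  finally show ?case by simp
next
  case (Suc N)
  obtain n' where n: "n = Suc n'" using Suc.prems by (cases n) auto
  define x :: "nat \<Rightarrow> complex" where "x k = of_nat k * (of_nat k + 1)" for k
  define w :: "nat \<Rightarrow> nat \<Rightarrow> complex" where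
    "w n k = (-1) ^ k * (2 * of_nat k + 1) / (fact (n - k) * fact (n + k + 1))" for n k
  define p where "p k = (\<Prod>r<N. \<alpha> r + \<beta> r * x k)" for k
  have IH: "(\<Sum>k\<le>n. w n k * p k) = 0" "(\<Sum>k\<le>n'. w n' k * p k) = 0"
    unfolding w_def p_def x_def by (rule Suc.IH, use Suc.prems n in simp)+
  \<comment> \<open>Multiplication by \<open>x n - x k = (n - k) * (n + k + 1)\<close> removes the
    node \<open>x n\<close> from the weight and leaves the weight for \<open>n - 1\<close>.\<close>
  have w: "w n k * (x n - x k) = w n' k" if k: "k \<le> n'" for k
  proof -
    obtain d where d: "n' = k + d" using k by (auto simp: le_iff_add)
    have "x n - x k = (1 + of_nat d) * (of_nat (2 * k + d) + 2)"
      by (simp add: x_def n d algebra_simps)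
    moreover have "(1 + of_nat d :: complex) \<noteq> 0" "(of_nat (2 * k + d) + 2 :: complex) \<noteq> 0"
      using of_nat_neq_0[of d, where 'a = complex] of_nat_neq_0[of "2 * k + d + 1", where 'a = complex]
      by (simp_all add: algebra_simps)
    moreover have "fact (n - k) = (1 + of_nat d) * (fact (n' - k) :: complex)"
      "fact (n + k + 1) = (of_nat (2 * k + d) + 2) * (fact (n' + k + 1) :: complex)"
      by (simp_all add: n d algebra_simps)
    ultimately show ?thesis unfolding w_def by (simp only: mult_ac) simp
  qed
  have "(\<Sum>k\<le>n. w n k * (x n - x k) * p k) = 0"
    using IH(2) w by (simp add: n)
  \<comment> \<open>The new factor at \<open>x k\<close> is its value at \<open>x n\<close> minus
    \<open>\<beta> N * (x n - x k)\<close>. The first part is the induction hypothesis for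
    \<open>n\<close>, the second the one for \<open>n - 1\<close>.\<close>
  then have "(\<alpha> N + \<beta> N * x n) * (\<Sum>k\<le>n. w n k * p k) - \<beta> N * (\<Sum>k\<le>n. w n k * (x n - x k) * p k) = 0"
    using IH(1) by simp
  then have "(\<Sum>k\<le>n. w n k * (p k * (\<alpha> N + \<beta> N * x k))) = 0"
    unfolding sum_distrib_left sum_subtractf[symmetric] by (simp add: algebra_simps)
  then show ?case by (simp add: w_def p_def x_def)
qed

text \<open>The lower parameters lie symmetrically about \<open>h\<close>, so
  \<open>(e k + r) * (f k + r)\<close> is linear in \<open>k * (k + 1)\<close>. The two denominators
  cancel the last factors of the Pochhammer symbols and lower the degree from \<open>n\<close> to
  \<open>n - 1\<close>, just enough for all \<open>j < n\<close> to drop out.\<close>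

lemma well_poised_sum_whipple_sum:
  fixes h \<mu> c :: complex
  assumes e: "\<And>k. k \<le> n \<Longrightarrow> h + \<mu> * (of_nat k + 1 / 2) \<notin> \<int>"
    and f: "\<And>k. k \<le> n \<Longrightarrow> h - \<mu> * (of_nat k + 1 / 2) \<notin> \<int>"
  defines "e \<equiv> \<lambda>k. h + \<mu> * (of_nat k + 1 / 2)" and "f \<equiv> \<lambda>k. h - \<mu> * (of_nat k + 1 / 2)"
  shows "(\<Sum>k\<le>n. (-1) ^ k * (2 * of_nat k + 1) / (fact (n - k) * fact (n + k + 1))
           * (pochhammer (e k) n * pochhammer (f k) n / ((e k + of_nat n - 1) * (f k + of_nat n - 1)))
           * whipple_sum k c (e k) (f k))
       = pochhammer c n / (fact n * (e n + of_nat n - 1) * (f n + of_nat n - 1))"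
proof -
  define w :: "nat \<Rightarrow> complex" where
    "w k = (-1) ^ k * (2 * of_nat k + 1) / (fact (n - k) * fact (n + k + 1))" for k
  define p where
    "p k = pochhammer (e k) n * pochhammer (f k) n / ((e k + of_nat n - 1) * (f k + of_nat n - 1))" for k
  have nz: "pochhammer (e k) j \<noteq> 0" "pochhammer (f k) j \<noteq> 0"
      "e k + of_nat n - 1 \<noteq> 0" "f k + of_nat n - 1 \<noteq> 0" if "k \<le> n" for k j
  proof -
    have "e k \<notin> \<int>" "f k \<notin> \<int>" using that assms(1,2) by (simp_all add: e_def f_def)
    moreover from this have "e k - 1 \<notin> \<int>" "f k - 1 \<notin> \<int>"
      by (auto intro: not_Int_shift[of "e k"] not_Int_shift[of "f k"])
    ultimately show "pochhammer (e k) j \<noteq> 0" "pochhammer (f k) j \<noteq> 0"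
      "e k + of_nat n - 1 \<noteq> 0" "f k + of_nat n - 1 \<noteq> 0"
      using not_Int_add_nat[of "e k - 1" n] not_Int_add_nat[of "f k - 1" n]
      by (simp_all add: pochhammer_nonzero_of_not_Int algebra_simps)
  qed
  have low: "(\<Sum>k\<le>n. w k * p k * whipple_term (of_nat k) c (e k) (f k) j) = 0" if j: "j < n" for j
  proof -
    obtain d where d: "n = Suc (j + d)" using j by (metis less_iff_Suc_add)
    \<comment> \<open>Linear factors in \<open>k * (k + 1)\<close>: for \<open>r < j\<close> they
      are \<open>(r - k) * (r + k + 1)\<close>, from the upper parameters of the series; for the
      others they are \<open>(e k + r) * (f k + r)\<close>.\<close>
    define \<alpha> where "\<alpha> r = (if r < j then of_nat r * (of_nat r + 1) else (h + of_nat r)\<^sup>2 - \<mu>\<^sup>2 / 4)" for r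
    define \<beta> where "\<beta> r = (if r < j then - 1 else - \<mu>\<^sup>2)" for r :: nat
    have "p k * whipple_term (of_nat k) c (e k) (f k) j
        = pochhammer c j / fact j * (\<Prod>r<n - 1. \<alpha> r + \<beta> r * (of_nat k * (of_nat k + 1)))"
      if k: "k \<le> n" for k
    proof -
      \<comment> \<open>The first \<open>j\<close> factors cancel against the denominator of the
        series term and the last one against the denominator of \<open>p k\<close>.\<close>
      have split: "pochhammer z n = pochhammer z j * (\<Prod>r=j..<n - 1. z + of_nat r) * (z + of_nat n - 1)"
        for z :: complex
        by (simp add: pochhammer_prod d prod.atLeastLessThan_concat mult.assoc[symmetric]
            prod.atLeastLessThan_concat[of 0 j "j + d"])
      have "p k * whipple_term (of_nat k) c (e k) (f k) j
        = pochhammer c j / fact j * ((pochhammer (- of_nat k) j * pochhammer (of_nat k + 1) j)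
          * ((\<Prod>r=j..<n - 1. e k + of_nat r) * (\<Prod>r=j..<n - 1. f k + of_nat r)))"
        unfolding p_def whipple_term_def split using nz[OF k] by (simp add: mult_ac)
      also have "pochhammer (- of_nat k) j * pochhammer (of_nat k + 1) j
         = (\<Prod>r=0..<j. \<alpha> r + \<beta> r * (of_nat k * (of_nat k + 1)))"
        unfolding pochhammer_prod prod.distrib[symmetric]
        by (rule prod.cong) (auto simp: \<alpha>_def \<beta>_def algebra_simps)
      also have "(\<Prod>r=j..<n - 1. e k + of_nat r) * (\<Prod>r=j..<n - 1. f k + of_nat r)
         = (\<Prod>r=j..<n - 1. \<alpha> r + \<beta> r * (of_nat k * (of_nat k + 1)))"
        unfolding prod.distrib[symmetric]
        by (rule prod.cong) (auto simp: \<alpha>_def \<beta>_def e_def f_def field_simps power2_eq_square)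
      also have "(\<Prod>r=0..<j. \<alpha> r + \<beta> r * (of_nat k * (of_nat k + 1)))
          * (\<Prod>r=j..<n - 1. \<alpha> r + \<beta> r * (of_nat k * (of_nat k + 1)))
         = (\<Prod>r<n - 1. \<alpha> r + \<beta> r * (of_nat k * (of_nat k + 1)))"
        unfolding lessThan_atLeast0 by (rule prod.atLeastLessThan_concat) (simp_all add: d)
      finally show ?thesis .
    qed
    then have "w k * p k * whipple_term (of_nat k) c (e k) (f k) j
      = pochhammer c j / fact j * (w k * (\<Prod>r<n - 1. \<alpha> r + \<beta> r * (of_nat k * (of_nat k + 1))))"
      if "k \<le> n" for k
      using that by (simp only: mult.assoc mult.left_commute[of "w k"])
    then have "(\<Sum>k\<le>n. w k * p k * whipple_term (of_nat k) c (e k) (f k) j)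
      = pochhammer c j / fact j * (\<Sum>k\<le>n. w k * (\<Prod>r<n - 1. \<alpha> r + \<beta> r * (of_nat k * (of_nat k + 1))))"
      unfolding sum_distrib_left by (intro sum.cong) simp_all
    also have "\<dots> = 0"
      unfolding w_def using well_poised_sum_linear_factors[of "n - 1" n \<alpha> \<beta>] j by simp
    finally show ?thesis .
  qed
  have top: "(\<Sum>k\<le>n. w k * p k * whipple_term (of_nat k) c (e k) (f k) n)
     = w n * p n * whipple_term (of_nat n) c (e n) (f n) n"
    unfolding lessThan_Suc_atMost[symmetric] sum.lessThan_Suc by (simp add: whipple_term_eq_0)
  have "(\<Sum>k\<le>n. w k * p k * whipple_sum k c (e k) (f k))
      = (\<Sum>k\<le>n. \<Sum>j\<le>n. w k * p k * whipple_term (of_nat k) c (e k) (f k) j)"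
    by (simp add: whipple_sum_extend[of _ n] sum_distrib_left)
  also have "\<dots> = (\<Sum>j\<le>n. \<Sum>k\<le>n. w k * p k * whipple_term (of_nat k) c (e k) (f k) j)"
    by (rule sum.swap)
  also have "\<dots> = w n * p n * whipple_term (of_nat n) c (e n) (f n) n"
    using low top unfolding lessThan_Suc_atMost[symmetric] sum.lessThan_Suc by simp
  also have "\<dots> = pochhammer c n / (fact n * (e n + of_nat n - 1) * (f n + of_nat n - 1))"
  proof -
    have "fact n * pochhammer (of_nat n + 1) n = (fact (2 * n) :: complex)"
      using pochhammer_product'[of "1::complex" n n] by (simp add: pochhammer_fact add.commute flip: mult_2)
    then have P: "pochhammer (- of_nat n) n * pochhammer (of_nat n + 1) n = (-1) ^ n * (fact (2 * n) :: complex)"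
      by (simp add: pochhammer_same)
    have wn: "w n = (-1) ^ n / fact (2 * n)"
      using of_nat_neq_0[of "2 * n", where 'a = complex] by (simp add: w_def add.commute flip: mult_2)
    have pn: "p n * whipple_term (of_nat n) c (e n) (f n) n = (-1) ^ n * fact (2 * n) * pochhammer c n /
      (fact n * (e n + of_nat n - 1) * (f n + of_nat n - 1))"
      unfolding p_def whipple_term_def P using nz[of n] by (simp add: mult_ac)
    show ?thesis
      unfolding mult.assoc[of "w n"] pn unfolding wn by (cases "even n") simp_all
  qed
  finally show ?thesis by (simp add: w_def p_def)
qed

section \<open>The summands of \<open>Omega\<close> in terms of \<open>P\<close> and
  \<open>Q\<close>\<close>

definition Omega_term :: "complex \<Rightarrow> complex \<Rightarrow> nat \<Rightarrow> nat \<Rightarrow> nat \<Rightarrow> nat \<Rightarrow> complex" where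
  "Omega_term l a i m n k = (\<Prod>z\<leftarrow>num_args l a i m n k. Gamma z) * (\<Prod>z\<leftarrow>den_args l a i m n k. rGamma z)
     * ((-1) ^ k / fact k)"

lemma Omega_eq: "Omega l a i m n = (\<Sum>k\<le>n. Omega_term l a i m n k)"
  by (simp add: Omega_def Omega_term_def atLeast0AtMost)

text \<open>Gamma quotients whose arguments differ by an integer collapse: those with a difference
  of 1 give \<open>(2 * k + 1) / 2\<close> and \<open>(y + m - 2 * i) / 2\<close>, hence the 4, and
  the one with difference \<open>m + 1\<close> gives the Pochhammer symbol.\<close>

lemma Omega_term_eq:
  fixes a l :: complex and k m n i :: nat
  defines "P \<equiv> (1 + 2 * l) * of_nat k + 2 * l - 2 * a" and "Q \<equiv> (1 + 2 * l) * of_nat k + 2 * a"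
  defines "y \<equiv> P + Q + 1"
  assumes i: "i \<le> m" and k: "k \<le> n"
    and num: "\<And>z. z \<in> set (num_args l a i m n k) \<Longrightarrow> z \<notin> \<int>\<^sub>\<le>\<^sub>0"
  shows "Omega_term l a i m n k = (-1) ^ k * (2 * of_nat k + 1) / (fact (n - k) * fact (n + k + 1))
     * (Gamma (Q + 1 + of_nat n) * rGamma (P + 1 - of_nat n)) / 4
     * ((y + of_nat m - 2 * of_nat i) / pochhammer (y - of_nat i) (Suc m) * gamma_ratio k m i P Q)"
proof -
  define K :: complex where "K = of_nat k"
  define M :: complex where "M = of_nat m"
  define I :: complex where "I = of_nat i"
  define N :: complex where "N = of_nat n"
  define z where "z = (y + M) / 2 - I"
  have nums: "num_args l a i m n k = [1 + K, 3 / 2 + K, (P - K + M - I) / 2, (P + K + 1 + M - I) / 2,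
      z + 1, Q + 1 + N, y - I]"
    by (simp add: num_args_def K_def M_def I_def N_def z_def y_def P_def Q_def field_simps)
  have dens: "den_args l a i m n k = [1 + of_nat (n - k), 1 + of_nat (n + k + 1), 1 / 2 + K, (Q - K + 2 - I) / 2,
      (Q + K + 3 - I) / 2, z, P + 1 - N, y - I + of_nat (Suc m)]"
    using k by (simp add: den_args_def K_def M_def I_def N_def z_def y_def P_def Q_def field_simps of_nat_diff)
  have np: "1 + K \<notin> \<int>\<^sub>\<le>\<^sub>0" "3 / 2 + K \<notin> \<int>\<^sub>\<le>\<^sub>0" "z + 1 \<notin> \<int>\<^sub>\<le>\<^sub>0" "y - I \<notin> \<int>\<^sub>\<le>\<^sub>0"
    using num by (simp_all add: nums)
  have f: "Gamma (1 + K) = fact k" "rGamma (1 + of_nat (n - k)) = 1 / (fact (n - k) :: complex)"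
     "rGamma (1 + of_nat (n + k + 1)) = 1 / (fact (n + k + 1) :: complex)"
    by (simp_all only: K_def Gamma_fact rGamma_inverse_Gamma inverse_eq_divide)
  have 1: "Gamma (3 / 2 + K) * rGamma (1 / 2 + K) = (2 * K + 1) / 2"
  proof -
    have "Gamma (3 / 2 + K) * rGamma (3 / 2 + K) = 1"
      using np(2) by (simp add: rGamma_inverse_Gamma Gamma_eq_zero_iff)
    moreover have "rGamma (1 / 2 + K) = (1 / 2 + K) * rGamma (3 / 2 + K)"
      using rGamma_plus1[of "1 / 2 + K"] by (simp add: add_ac)
    ultimately have "Gamma (3 / 2 + K) * rGamma (1 / 2 + K) = 1 / 2 + K" by algebra
    then show ?thesis by (simp add: add_divide_distrib)
  qed
  have 2: "Gamma (z + 1) * rGamma z = (y + M - 2 * I) / 2"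
  proof -
    have "Gamma (z + 1) * rGamma (z + 1) = 1"
      using np(3) by (simp add: rGamma_inverse_Gamma Gamma_eq_zero_iff)
    then have "Gamma (z + 1) * rGamma z = z"
      unfolding rGamma_plus1[of z, symmetric] by algebra
    then show ?thesis by (simp add: z_def diff_divide_distrib)
  qed
  have 3: "Gamma (y - I) * rGamma (y - I + of_nat (Suc m)) = 1 / pochhammer (y - I) (Suc m)"
    unfolding pochhammer_Gamma[OF np(4)] by (simp add: rGamma_inverse_Gamma divide_inverse)
  have g: "gamma_ratio k m i P Q = Gamma ((P - K + M - I) / 2) * Gamma ((P + K + 1 + M - I) / 2)
      * (rGamma ((Q - K + 2 - I) / 2) * rGamma ((Q + K + 3 - I) / 2))"
    unfolding gamma_ratio_def rGamma_inverse_Gamma K_def M_def I_def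
    by (simp only: divide_inverse inverse_mult_distrib)
  have "Omega_term l a i m n k = (-1) ^ k * Gamma (1 + K) / fact k
      * rGamma (1 + of_nat (n - k)) * rGamma (1 + of_nat (n + k + 1))
      * (Gamma (3 / 2 + K) * rGamma (1 / 2 + K)) * (Gamma (z + 1) * rGamma z)
      * (Gamma (y - I) * rGamma (y - I + of_nat (Suc m)))
      * gamma_ratio k m i P Q * (Gamma (Q + 1 + N) * rGamma (P + 1 - N))"
    unfolding Omega_term_def nums dens g by (simp only: list.map prod_list.Cons prod_list.Nil mult_1_left mult_1_right divide_inverse mult_ac)
  also have "\<dots> = (-1) ^ k * (2 * K + 1) / (fact (n - k) * fact (n + k + 1))
     * (Gamma (Q + 1 + N) * rGamma (P + 1 - N)) / 4
     * ((y + M - 2 * I) / pochhammer (y - I) (Suc m) * gamma_ratio k m i P Q)"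
    unfolding 1 2 3 f by (simp add: mult_ac)
  finally show ?thesis by (simp only: K_def M_def I_def N_def)
qed

section \<open>The identity for non-integer \<open>P\<close> and \<open>Q\<close>\<close>

lemma Omega_sum_generic:
  fixes a l :: complex and m n :: nat
  assumes num: "\<And>i k z. i \<le> m \<Longrightarrow> k \<le> n \<Longrightarrow> z \<in> set (num_args l a i m n k) \<Longrightarrow> z \<notin> \<int>\<^sub>\<le>\<^sub>0"
    and Pn: "\<And>k. k \<le> n \<Longrightarrow> (1 + 2 * l) * of_nat k + 2 * l - 2 * a \<notin> \<int>"
    and Qn: "\<And>k. k \<le> n \<Longrightarrow> (1 + 2 * l) * of_nat k + 2 * a \<notin> \<int>"
  shows "(\<Sum>i=0..m. (-1) ^ i * (pochhammer (- of_nat m) i / fact i) * Omega l a i m n) =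
    ((-1) ^ n * 2 powr (4 * a - 2 * l - of_nat m - 1) * pochhammer (1 + 2 * a - l - of_nat m / 2) n)
    / ((1 + 2 * a + 2 * l * of_nat n + 2 * of_nat n) * (l - a + l * of_nat n) * pochhammer 1 n)"
proof -
  \<comment> \<open>\<open>\<mu>\<close> and \<open>h\<close> are chosen such that the lower
    parameters become \<open>Q k + 2\<close> and \<open>1 - P k\<close>.\<close>
  define \<mu> where "\<mu> = 1 + 2 * l"
  define h where "h = 3 / 2 + 2 * a - l"
  define P where "P k = (1 + 2 * l) * of_nat k + 2 * l - 2 * a" for k :: nat
  define Q where "Q k = (1 + 2 * l) * of_nat k + 2 * a" for k :: nat
  define y where "y k = P k + Q k + 1" for k
  define c where "c = 1 + 2 * a - l - of_nat m / 2"
  define w :: "nat \<Rightarrow> complex" where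
    "w k = (-1) ^ k * (2 * of_nat k + 1) / (fact (n - k) * fact (n + k + 1))" for k
  define G where "G k = Gamma (Q k + 1 + of_nat n) * rGamma (P k + 1 - of_nat n)" for k
  define S where "S k = (\<Sum>i\<le>m. of_nat (m choose i) * (y k + of_nat m - 2 * of_nat i)
            / pochhammer (y k - of_nat i) (Suc m) * gamma_ratio k m i (P k) (Q k))" for k
  have eQ: "h + \<mu> * (of_nat k + 1 / 2) = Q k + 2" and eP: "h - \<mu> * (of_nat k + 1 / 2) = 1 - P k" for k
    by (simp_all add: h_def \<mu>_def P_def Q_def field_simps)
  have PI: "P k \<notin> \<int>" and QI: "Q k \<notin> \<int>" if "k \<le> n" for k
    using Pn[OF that] Qn[OF that] by (simp_all add: P_def Q_def)
  have PI': "1 - P k \<notin> \<int>" and QI': "Q k + 2 \<notin> \<int>" if "k \<le> n" for k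
  proof -
    show "1 - P k \<notin> \<int>"
      using PI[OF that] by (metis Ints_1 Ints_diff diff_diff_eq2 add_diff_cancel_left')
    show "Q k + 2 \<notin> \<int>"
      by (rule not_Int_shift[OF QI[OF that]]) simp
  qed
  have binom: "(-1) ^ i * (pochhammer (- of_nat m) i / fact i) = (of_nat (m choose i) :: complex)" for i
    by (simp add: binomial_gbinomial gbinomial_pochhammer)
  \<comment> \<open>The last numerator argument is \<open>y k - i\<close>. That it is no pole for
    \<open>i = m\<close> excludes all zeros of \<open>y k + j\<close> with
    \<open>j \<ge> - m\<close>.\<close>
  have y: "y k + of_int j \<noteq> 0" if k: "k \<le> n" and j: "\<bar>j\<bar> \<le> int m" for k j
  proof -
    have yk: "1 - of_nat i + 2 * l + (2 + 4 * l) * of_nat k = y k - of_nat i" for i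
      by (simp add: y_def P_def Q_def algebra_simps)
    have "y k - of_nat m \<notin> \<int>\<^sub>\<le>\<^sub>0"
      using num[of m k "1 - of_nat m + 2 * l + (2 + 4 * l) * of_nat k"] k
      unfolding yk by (simp add: num_args_def yk)
    then have "y k - of_nat m \<noteq> - of_nat (nat (j + int m))"
      by auto
    moreover have "(of_nat (nat (j + int m)) :: complex) = of_int j + of_nat m"
      using j by (simp add: of_nat_nat)
    ultimately show ?thesis by (simp add: algebra_simps eq_neg_iff_add_eq_0)
  qed
  have S: "S k = 2 powr (2 + 4 * a - 2 * l) / 2 ^ m * Gamma (P k) / Gamma (Q k + 2) * whipple_sum k c (Q k + 2) (1 - P k)"
    if k: "k \<le> n" for k
  proof -
    \<comment> \<open>As this difference is free of \<open>k\<close>, so are the power of 2 and the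
      parameter \<open>c\<close>.\<close>
    have d: "Q k - P k = 4 * a - 2 * l" by (simp add: P_def Q_def algebra_simps)
    have eq: "2 + Q k - P k = 2 + 4 * a - 2 * l" "1 + (Q k - P k - of_nat m) / 2 = c"
      using d by algebra (simp add: d c_def diff_divide_distrib)
    have "S k = 2 powr (2 + Q k - P k) / 2 ^ m * Gamma (P k) / Gamma (Q k + 2)
           * whipple_sum k (1 + (Q k - P k - of_nat m) / 2) (Q k + 2) (1 - P k)"
      unfolding S_def y_def by (rule gamma_ratio_sum[OF PI[OF k] QI[OF k] y[OF k, unfolded y_def]])
    then show ?thesis unfolding eq .
  qed
  \<comment> \<open>The Gamma factors free of \<open>i\<close> combine with those from the sum over
    \<open>i\<close> to the weight of \<open>well_poised_sum_whipple_sum\<close>. The sign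
    \<open>(-1) ^ n\<close> comes from reversing \<open>pochhammer (1 - P k) n\<close>, the minus
    from the last factor \<open>- (P k - n)\<close>.\<close>
  have G: "G k * (Gamma (P k) / Gamma (Q k + 2))
      = - ((-1) ^ n) * (pochhammer (Q k + 2) n * pochhammer (1 - P k) n
         / ((Q k + 2 + of_nat n - 1) * (1 - P k + of_nat n - 1)))" if k: "k \<le> n" for k
  proof -
    have i: "Q k + 1 + of_nat n \<notin> \<int>" "P k - of_nat n \<notin> \<int>"
      by (rule not_Int_shift[OF QI[OF k]], simp) (rule not_Int_shift[OF PI[OF k]], simp)
    then have nz: "Q k + 1 + of_nat n \<noteq> 0" "P k - of_nat n \<noteq> 0" by (metis Ints_0)+
    have "pochhammer (Q k + 2) n = Gamma (Q k + 1 + of_nat n + 1) / Gamma (Q k + 2)"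
      using pochhammer_Gamma[OF not_Int_imp_not_nonpos[OF QI'[OF k]], of n] by (simp add: algebra_simps)
    also have "Gamma (Q k + 1 + of_nat n + 1) = (Q k + 1 + of_nat n) * Gamma (Q k + 1 + of_nat n)"
      by (rule Gamma_plus1[OF not_Int_imp_not_nonpos[OF i(1)]])
    finally have 1: "pochhammer (Q k + 2) n = (Q k + 1 + of_nat n) * Gamma (Q k + 1 + of_nat n) / Gamma (Q k + 2)" .
    have "pochhammer (1 - P k) n = (-1) ^ n * pochhammer (P k - of_nat n) n"
      using pochhammer_minus[of "P k - 1" n] by simp
    also have "pochhammer (P k - of_nat n) n = Gamma (P k) / Gamma (P k - of_nat n)"
      using pochhammer_Gamma[OF not_Int_imp_not_nonpos[OF i(2)], of n] by simp
    finally have 2: "pochhammer (1 - P k) n = (-1) ^ n * (Gamma (P k) / Gamma (P k - of_nat n))" .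
    have "Gamma (P k - of_nat n + 1) = (P k - of_nat n) * Gamma (P k - of_nat n)"
      by (rule Gamma_plus1[OF not_Int_imp_not_nonpos[OF i(2)]])
    then have 3: "rGamma (P k + 1 - of_nat n) = 1 / ((P k - of_nat n) * Gamma (P k - of_nat n))"
      by (simp add: rGamma_inverse_Gamma divide_inverse algebra_simps)
    have 4: "Q k + 2 + of_nat n - 1 = Q k + 1 + of_nat n" "1 - P k + of_nat n - 1 = - (P k - of_nat n)"
      by simp_all
    have sq: "(-1) ^ n * (-1) ^ n = (1 :: complex)" by (simp flip: power_mult_distrib)
    have "A * (1 / (D * Gd)) * (Gp / Gq) = - s * ((B * A / Gq) * (s * (Gp / Gd)) / (B * - D))"
      if "B \<noteq> 0" "D \<noteq> 0" "s * s = 1" for A B D Gd Gp Gq s :: complex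
    proof -
      have "- s * ((B * A / Gq) * (s * (Gp / Gd)) / (B * - D)) = (s * s) * ((B * A / Gq) * (Gp / Gd) / (B * D))"
        by simp
      also have "\<dots> = A * (1 / (D * Gd)) * (Gp / Gq)"
        unfolding that(3) using that(1,2) by (simp add: mult_ac)
      finally show ?thesis ..
    qed
    from this[OF nz sq] show ?thesis unfolding G_def 1 2 3 4 .
  qed
  have "(\<Sum>i=0..m. (-1) ^ i * (pochhammer (- of_nat m) i / fact i) * Omega l a i m n)
      = (\<Sum>i\<le>m. \<Sum>k\<le>n. of_nat (m choose i) * Omega_term l a i m n k)"
    unfolding binom Omega_eq sum_distrib_left atLeast0AtMost ..
  also have "\<dots> = (\<Sum>k\<le>n. \<Sum>i\<le>m. of_nat (m choose i) * Omega_term l a i m n k)"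
    by (rule sum.swap)
  also have "\<dots> = (\<Sum>k\<le>n. w k * G k / 4 * S k)"
  proof (rule sum.cong[OF refl])
    fix k assume "k \<in> {..n}"
    then have k: "k \<le> n" by simp
    have "of_nat (m choose i) * Omega_term l a i m n k = w k * G k / 4 * (of_nat (m choose i)
        * (y k + of_nat m - 2 * of_nat i) / pochhammer (y k - of_nat i) (Suc m) * gamma_ratio k m i (P k) (Q k))"
      if i: "i \<le> m" for i
    proof -
      have *: "Omega_term l a i m n k = w k * G k / 4 * ((y k + of_nat m - 2 * of_nat i)
          / pochhammer (y k - of_nat i) (Suc m) * gamma_ratio k m i (P k) (Q k))"
        unfolding w_def G_def y_def P_def Q_def by (rule Omega_term_eq[OF i k num[OF i k]])
      show ?thesis unfolding * by simp
    qed
    then show "(\<Sum>i\<le>m. of_nat (m choose i) * Omega_term l a i m n k) = w k * G k / 4 * S k"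
      unfolding S_def sum_distrib_left by (intro sum.cong) auto
  qed
  also have "\<dots> = - ((-1) ^ n * 2 powr (2 + 4 * a - 2 * l) / (4 * 2 ^ m)) *
      (\<Sum>k\<le>n. w k * (pochhammer (Q k + 2) n * pochhammer (1 - P k) n
         / ((Q k + 2 + of_nat n - 1) * (1 - P k + of_nat n - 1))) * whipple_sum k c (Q k + 2) (1 - P k))"
    unfolding sum_distrib_left
  proof (rule sum.cong[OF refl])
    fix k assume "k \<in> {..n}"
    then have k: "k \<le> n" by simp
    have "w k * G k / 4 * S k = 2 powr (2 + 4 * a - 2 * l) / (4 * 2 ^ m) * w k
        * (G k * (Gamma (P k) / Gamma (Q k + 2))) * whipple_sum k c (Q k + 2) (1 - P k)"
      unfolding S[OF k] by (simp add: mult_ac)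
    then show "w k * G k / 4 * S k = - ((-1) ^ n * 2 powr (2 + 4 * a - 2 * l) / (4 * 2 ^ m)) *
      (w k * (pochhammer (Q k + 2) n * pochhammer (1 - P k) n
         / ((Q k + 2 + of_nat n - 1) * (1 - P k + of_nat n - 1))) * whipple_sum k c (Q k + 2) (1 - P k))"
      unfolding G[OF k] by (simp add: mult_ac)
  qed
  also have "(\<Sum>k\<le>n. w k * (pochhammer (Q k + 2) n * pochhammer (1 - P k) n
         / ((Q k + 2 + of_nat n - 1) * (1 - P k + of_nat n - 1))) * whipple_sum k c (Q k + 2) (1 - P k))
      = pochhammer c n / (fact n * (Q n + 2 + of_nat n - 1) * (1 - P n + of_nat n - 1))"
    using well_poised_sum_whipple_sum[of n h \<mu> c] PI' QI' unfolding eP eQ w_def by blast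
  \<comment> \<open>The factor \<open>- 2\<close> cancels the minus sign in front and turns the 4
    into 8, so the power of 2 drops by \<open>m + 3\<close>.\<close>
  also have "1 - P n + of_nat n - 1 = - 2 * (l - a + l * of_nat n)"
    by (simp add: P_def algebra_simps)
  also have "Q n + 2 + of_nat n - 1 = 1 + 2 * a + 2 * l * of_nat n + 2 * of_nat n"
    by (simp add: Q_def algebra_simps)
  also have "- ((-1) ^ n * 2 powr (2 + 4 * a - 2 * l) / (4 * 2 ^ m)) *
      (pochhammer c n / (fact n * (1 + 2 * a + 2 * l * of_nat n + 2 * of_nat n) * (- 2 * (l - a + l * of_nat n))))
     = (-1) ^ n * (2 powr (2 + 4 * a - 2 * l) / (8 * 2 ^ m)) * pochhammer c n
       / ((1 + 2 * a + 2 * l * of_nat n + 2 * of_nat n) * (l - a + l * of_nat n) * fact n)"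
  proof -
    have "- (s * p / (4 * M)) * (C / (F * X * (- 2 * Y))) = s * (p / (8 * M)) * C / (X * Y * F)"
      for s p M C F X Y :: complex
      by (simp add: mult_ac)
    then show ?thesis .
  qed
  also have "2 powr (2 + 4 * a - 2 * l) / (8 * 2 ^ m) = (2::complex) powr (4 * a - 2 * l - of_nat m - 1)"
  proof -
    have "(2::complex) powr (2 + 4 * a - 2 * l) = 2 powr ((4 * a - 2 * l - of_nat m - 1) + of_nat (m + 3))"
      by (simp add: algebra_simps)
    also have "\<dots> = 2 powr (4 * a - 2 * l - of_nat m - 1) * 2 powr (of_nat (m + 3))"
      by (rule powr_add)
    also have "(2::complex) powr (of_nat (m + 3)) = 2 ^ (m + 3)"
      by (rule powr_nat') simp
    finally show ?thesis by (simp add: power_add)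
  qed
  finally show ?thesis unfolding c_def pochhammer_fact .
qed

section \<open>Extension to all admissible \<open>a\<close> by continuity\<close>

theorem theorem3:
  fixes a l :: complex and m n :: nat
  assumes num: "\<And>i k z. i \<le> m \<Longrightarrow> k \<le> n \<Longrightarrow> z \<in> set (num_args l a i m n k) \<Longrightarrow> z \<notin> \<int>\<^sub>\<le>\<^sub>0"
    and den1: "1 + 2 * a + 2 * l * of_nat n + 2 * of_nat n \<noteq> 0"
    and den2: "l - a + l * of_nat n \<noteq> 0"
  shows "(\<Sum>i=0..m. (-1) ^ i * (pochhammer (- of_nat m) i / fact i) * Omega l a i m n) =
    ((-1) ^ n * 2 powr (4 * a - 2 * l - of_nat m - 1) * pochhammer (1 + 2 * a - l - of_nat m / 2) n)
    / ((1 + 2 * a + 2 * l * of_nat n + 2 * of_nat n) * (l - a + l * of_nat n) * pochhammer 1 n)"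
proof -
  define L where "L t = (\<Sum>i=0..m. (-1) ^ i * (pochhammer (- of_nat m) i / fact i) * Omega l t i m n)" for t
  define R where "R t = ((-1) ^ n * 2 powr (4 * t - 2 * l - of_nat m - 1) * pochhammer (1 + 2 * t - l - of_nat m / 2) n)
    / ((1 + 2 * t + 2 * l * of_nat n + 2 * of_nat n) * (l - t + l * of_nat n) * pochhammer 1 n)" for t
  \<comment> \<open>The hypothesis \<open>num\<close> keeps the numerator arguments at
    \<open>a\<close> away from the poles of \<open>Gamma\<close>, and \<open>rGamma\<close> is
    entire.\<close>
  have "isCont (\<lambda>t. Omega_term l t i m n k) a" if "i \<le> m" "k \<le> n" for i k
    unfolding Omega_term_def num_args_def den_args_def list.map prod_list.Cons prod_list.Nil
    by (intro continuous_mult isCont_Gamma isCont_rGamma continuous_add continuous_diff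
        continuous_const continuous_ident; rule num[OF that]; simp add: num_args_def)
  then have "isCont L a"
    unfolding L_def Omega_eq by (intro continuous_mult continuous_sum continuous_const) auto
  then have "(L \<longlongrightarrow> L a) (at a)"
    by (simp add: isCont_def)
  moreover have "isCont R a"
  proof -
    have "isCont (\<lambda>t. pochhammer (1 + 2 * t - l - of_nat m / 2) n) a"
      by (rule isCont_o2[OF _ isCont_pochhammer]) (intro continuous_intros)
    moreover have "isCont (\<lambda>t. (2::complex) powr (4 * t - 2 * l - of_nat m - 1)) a"
      unfolding powr_def by simp
    ultimately show ?thesis
      unfolding R_def using den1 den2
      by (intro continuous_divide continuous_mult continuous_add continuous_diff continuous_const continuous_ident)
        (simp_all add: pochhammer_fact[symmetric])
  qed
  then have "(R \<longlongrightarrow> R a) (at a)"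
    by (simp add: isCont_def)
  moreover have "eventually (\<lambda>t. L t = R t) (at a)"
  proof -
    have "eventually (\<lambda>t. \<forall>k\<in>{..n}. ((1 + 2 * l) * of_nat k + 2 * l) + (-2) * t \<notin> \<int>) (at a)"
         "eventually (\<lambda>t. \<forall>k\<in>{..n}. (1 + 2 * l) * of_nat k + 2 * t \<notin> \<int>) (at a)"
      by (intro eventually_ball_finite ballI eventually_not_Int; simp)+
    then show ?thesis
    proof eventually_elim
      case (elim t)
      have P: "(1 + 2 * l) * of_nat k + 2 * l - 2 * t \<notin> \<int>" and Q: "(1 + 2 * l) * of_nat k + 2 * t \<notin> \<int>"
        if "k \<le> n" for k
        using elim that by auto
      \<comment> \<open>Only three numerator arguments depend on \<open>t\<close>. Twice the third
        and twice the fourth differ by integers from the expression in \<open>P\<close>, and the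
        sixth does so from that in \<open>Q\<close>; the other four are the same as for
        \<open>a\<close>.\<close>
      have "z \<notin> \<int>\<^sub>\<le>\<^sub>0" if i: "i \<le> m" and k: "k \<le> n" and z: "z \<in> set (num_args l t i m n k)" for i k z
      proof -
        have "(of_nat m - of_nat i) / 2 + l - t + l * of_nat k \<notin> \<int>"
          by (rule not_Int_half[OF P[OF k]]) (simp add: diff_divide_distrib add_divide_distrib algebra_simps)
        moreover have "(1 + of_nat m - of_nat i) / 2 + l - t + (1 + l) * of_nat k \<notin> \<int>"
          by (rule not_Int_half[OF P[OF k]]) (simp add: diff_divide_distrib add_divide_distrib algebra_simps)
        moreover have "1 + 2 * t + of_nat n + (1 + 2 * l) * of_nat k \<notin> \<int>"
          by (rule not_Int_shift[OF Q[OF k]]) (simp add: algebra_simps)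
        ultimately show ?thesis
          using z num[OF i k] unfolding num_args_def by (auto dest: not_Int_imp_not_nonpos)
      qed
      then show ?case
        unfolding L_def R_def by (rule Omega_sum_generic[OF _ P Q])
    qed
  qed
  ultimately have "L a = R a"
    by (metis tendsto_cong tendsto_unique trivial_limit_at)
  then show ?thesis unfolding L_def R_def .
qed

end
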